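(* Let $G=(V,E)$ be a connected graph with $n$ vertices, $m$ edges and unit edge lengths $\ell=1$. For any even integer $0\le k\le n$, the set $C$ of edges incident to the $k/2$ vertices of highest degree is a $(1,k)$-contraction of $G$ with $\Phi(C)\ge km/(2n)$. This contraction can be computed in time $O(m)$.
   Context: For $C\subseteq E$, $\ell_C$ equals $0$ on $C$ and $1$ elsewhere. A $(1,k)$-contraction is a set $C\subseteq E$ with $\mathrm{dist}_{\ell_C}(u,v)\ge\mathrm{dist}_\ell(u,v)-k$ for all vertices $u,v$. $G/C$ is the simple graph obtained from $G$ by contracting $C$, deleting loops and merging parallel edges, and $\Phi(C)=m(G)-m(G/C)$. *)

theory Defs
  imports Complex_Main "HOL-Library.Landau_Symbols"
begin

section \<open>Finite simple graphs and distances\<close>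

text \<open>A graph is given by a vertex set and a set of two-element vertex sets.\<close>

definition simple_graph :: "'a set \<Rightarrow> 'a set set \<Rightarrow> bool" where
  "simple_graph V E \<longleftrightarrow> finite V \<and> (\<forall>e\<in>E. e \<subseteq> V \<and> card e = 2)"

fun walk_edges :: "'a list \<Rightarrow> 'a set list" where
  "walk_edges (x # y # xs) = {x, y} # walk_edges (y # xs)"
| "walk_edges _ = []"

definition walks :: "'a set \<Rightarrow> 'a set set \<Rightarrow> 'a \<Rightarrow> 'a \<Rightarrow> 'a list set" where
  "walks V E u v = {p. p \<noteq> [] \<and> hd p = u \<and> last p = v \<and> set p \<subseteq> V \<and> set (walk_edges p) \<subseteq> E}"

definition connected_graph :: "'a set \<Rightarrow> 'a set set \<Rightarrow> bool" where
  "connected_graph V E \<longleftrightarrow>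
     simple_graph V E \<and> V \<noteq> {} \<and> (\<forall>u\<in>V. \<forall>v\<in>V. walks V E u v \<noteq> {})"

text \<open>The infimum is over a nonempty set only if \<open>u\<close> and \<open>v\<close> are connected; for unconnected
  vertices the value is meaningless. Edge lengths are meant to be nonnegative.\<close>

definition graph_dist :: "'a set \<Rightarrow> 'a set set \<Rightarrow> ('a set \<Rightarrow> real) \<Rightarrow> 'a \<Rightarrow> 'a \<Rightarrow> real" where
  "graph_dist V E l u v = (INF p\<in>walks V E u v. sum_list (map l (walk_edges p)))"

definition degree :: "'a set set \<Rightarrow> 'a \<Rightarrow> nat" where
  "degree E v = card {e \<in> E. v \<in> e}"

text \<open>Ties are broken arbitrarily: several sets \<open>S\<close> may consist of \<open>j\<close> vertices of highest
  degree.\<close>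

definition highest_degree_vertices :: "'a set \<Rightarrow> 'a set set \<Rightarrow> nat \<Rightarrow> 'a set \<Rightarrow> bool" where
  "highest_degree_vertices V E j S \<longleftrightarrow>
     S \<subseteq> V \<and> card S = j \<and> (\<forall>s\<in>S. \<forall>v\<in>V - S. degree E v \<le> degree E s)"

definition incident_edges :: "'a set set \<Rightarrow> 'a set \<Rightarrow> 'a set set" where
  "incident_edges E S = {e \<in> E. e \<inter> S \<noteq> {}}"

section \<open>Contractions\<close>

definition contracted_length :: "'a set set \<Rightarrow> 'a set \<Rightarrow> real" where
  "contracted_length C e = (if e \<in> C then 0 else 1)"

text \<open>\<open>(1,k)\<close>-contractions for unit edge lengths.\<close>

definition contraction :: "'a set \<Rightarrow> 'a set set \<Rightarrow> nat \<Rightarrow> 'a set set \<Rightarrow> bool" where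
  "contraction V E k C \<longleftrightarrow> C \<subseteq> E \<and>
     (\<forall>u\<in>V. \<forall>v\<in>V. graph_dist V E (contracted_length C) u v
                     \<ge> graph_dist V E (\<lambda>_. 1) u v - real k)"

text \<open>The vertices of \<open>G/C\<close> are the connected components of \<open>(V, C)\<close>. Since its edges form a set of
  two-element sets of components, parallel edges are merged and loops do not occur.\<close>

definition component :: "'a set \<Rightarrow> 'a set set \<Rightarrow> 'a \<Rightarrow> 'a set" where
  "component V C u = {v. walks V C u v \<noteq> {}}"

definition contracted_edges :: "'a set \<Rightarrow> 'a set set \<Rightarrow> 'a set set \<Rightarrow> 'a set set set" where
  "contracted_edges V E C =
     {{component V C u, component V C v} | u v. {u, v} \<in> E \<and> component V C u \<noteq> component V C v}"

definition \<Phi> :: "'a set \<Rightarrow> 'a set set \<Rightarrow> 'a set set \<Rightarrow> real" where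
  "\<Phi> V E C = real (card E) - real (card (contracted_edges V E C))"

section \<open>A word RAM with unit-cost instructions\<close>

text \<open>Control flow is structured. A program uses finitely many registers, and addresses
  a memory of words through them. A configuration is a pair of register and memory contents.\<close>

datatype prog =
  Skip
| Set nat nat
| Add nat nat nat
| Sub nat nat nat
| Load nat nat
| Store nat nat
| Seq prog prog
| IfLess nat nat prog prog
| WhileLess nat nat prog

type_synonym config = "(nat \<Rightarrow> nat) \<times> (nat \<Rightarrow> nat)"

text \<open>\<open>exec w P s t s'\<close>: on \<open>w\<close>-bit words, \<open>P\<close> started in \<open>s\<close> halts in \<open>s'\<close> after exactly \<open>t\<close>
  steps. Every instruction and every test of a loop or conditional counts as one step, and only
  sequencing is free. Computing a value that does not fit into a word blocks the execution, so that
  \<open>exec\<close> never holds for a run with an overflow. Subtraction is truncated at \<open>0\<close>.\<close>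

inductive exec :: "nat \<Rightarrow> prog \<Rightarrow> config \<Rightarrow> nat \<Rightarrow> config \<Rightarrow> bool" for w :: nat where
  Skip: "exec w Skip (R, M) 1 (R, M)"
| Set: "a < 2 ^ w \<Longrightarrow> exec w (Set x a) (R, M) 1 (R(x := a), M)"
| Add: "R y + R z < 2 ^ w \<Longrightarrow> exec w (Add x y z) (R, M) 1 (R(x := R y + R z), M)"
| Sub: "exec w (Sub x y z) (R, M) 1 (R(x := R y - R z), M)"
| Load: "exec w (Load x y) (R, M) 1 (R(x := M (R y)), M)"
| Store: "exec w (Store x y) (R, M) 1 (R, M(R x := R y))"
| Seq: "exec w P s t s' \<Longrightarrow> exec w Q s' t' s'' \<Longrightarrow> exec w (Seq P Q) s (t + t') s''"
| IfTrue: "R x < R y \<Longrightarrow> exec w P (R, M) t s' \<Longrightarrow> exec w (IfLess x y P Q) (R, M) (Suc t) s'"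
| IfFalse: "\<not> R x < R y \<Longrightarrow> exec w Q (R, M) t s' \<Longrightarrow> exec w (IfLess x y P Q) (R, M) (Suc t) s'"
| WhileTrue: "R x < R y \<Longrightarrow> exec w P (R, M) t s' \<Longrightarrow> exec w (WhileLess x y P) s' t' s'' \<Longrightarrow>
    exec w (WhileLess x y P) (R, M) (Suc (t + t')) s''"
| WhileFalse: "\<not> R x < R y \<Longrightarrow> exec w (WhileLess x y P) (R, M) 1 (R, M)"

inductive_cases exec_SkipE: "exec w Skip s t s'"
  and exec_SetE: "exec w (Set x a) s t s'"
  and exec_AddE: "exec w (Add x y z) s t s'"
  and exec_SubE: "exec w (Sub x y z) s t s'"
  and exec_LoadE: "exec w (Load x y) s t s'"
  and exec_StoreE: "exec w (Store x y) s t s'"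
  and exec_SeqE: "exec w (Seq P Q) s t s'"
  and exec_IfE: "exec w (IfLess x y P Q) (R, M) t s'"
  and exec_WhileE: "exec w (WhileLess x y P) (R, M) t s'"

lemma exec_deterministic:
  "exec w P s t s' \<Longrightarrow> exec w P s u s'' \<Longrightarrow> u = t \<and> s'' = s'"
proof (induction arbitrary: u s'' rule: exec.induct)
  case (Seq P s t s' Q t' s2)
  from Seq.prems obtain t1 s1 t2 where
    *: "exec w P s t1 s1" "exec w Q s1 t2 s''" "u = t1 + t2" by (rule exec_SeqE)
  from Seq.IH(1)[OF *(1)] have "t1 = t" "s1 = s'" by simp_all
  with Seq.IH(2)[of t2 s''] * show ?case by simp
next
  case (IfTrue R x y P M t s' Q)
  from IfTrue.prems obtain t1 where *: "exec w P (R, M) t1 s''" "u = Suc t1"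
    by (rule exec_IfE) (use IfTrue.hyps(1) in blast)+
  from IfTrue.IH[OF *(1)] * show ?case by simp
next
  case (IfFalse R x y Q M t s' P)
  from IfFalse.prems obtain t1 where *: "exec w Q (R, M) t1 s''" "u = Suc t1"
    by (rule exec_IfE) (use IfFalse.hyps(1) in blast)+
  from IfFalse.IH[OF *(1)] * show ?case by simp
next
  case (WhileTrue R x y P M t s' t' s2)
  from WhileTrue.prems obtain t1 s1 t2 where
    *: "exec w P (R, M) t1 s1" "exec w (WhileLess x y P) s1 t2 s''" "u = Suc (t1 + t2)"
    by (rule exec_WhileE) (use WhileTrue.hyps(1) in blast)+
  from WhileTrue.IH(1)[OF *(1)] have "t1 = t" "s1 = s'" by simp_all
  with WhileTrue.IH(2)[of t2 s''] * show ?case by simp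
next
  case (WhileFalse R x y P M)
  from WhileFalse.prems show ?case by (rule exec_WhileE) (use WhileFalse.hyps(1) in simp_all)
qed (erule exec_SkipE exec_SetE exec_AddE exec_SubE exec_LoadE exec_StoreE, simp)+

section \<open>Inputs and outputs\<close>

text \<open>Inputs are graphs on the vertices \<open>0, \<dots>, n - 1\<close>, given as a list of their edges in
  arbitrary order and orientation, without repetitions.\<close>

definition edge_at :: "(nat \<times> nat) list \<Rightarrow> nat \<Rightarrow> nat set" where
  "edge_at es i = {fst (es ! i), snd (es ! i)}"

definition edge_list :: "(nat \<times> nat) list \<Rightarrow> nat set set \<Rightarrow> bool" where
  "edge_list es E \<longleftrightarrow> bij_betw (edge_at es) {..<length es} E"

text \<open>Initially memory holds \<open>n\<close>, the number \<open>m\<close> of edges, \<open>k\<close> and the \<open>2 * m\<close> endpoints;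
  all other memory cells and all registers are \<open>0\<close>.\<close>

definition input_words :: "nat \<Rightarrow> (nat \<times> nat) list \<Rightarrow> nat \<Rightarrow> nat list" where
  "input_words n es k = [n, length es, k] @ concat (map (\<lambda>(u, v). [u, v]) es)"

definition initial_config :: "nat \<Rightarrow> (nat \<times> nat) list \<Rightarrow> nat \<Rightarrow> config" where
  "initial_config n es k =
     (\<lambda>_. 0, \<lambda>a. if a < length (input_words n es k) then input_words n es k ! a else 0)"

text \<open>An edge set is output as one mark per input edge, in the cells following the input.\<close>

definition outputs :: "(nat \<times> nat) list \<Rightarrow> config \<Rightarrow> nat set set \<Rightarrow> bool" where
  "outputs es s C \<longleftrightarrow>
     (\<forall>i<length es. snd s (3 + 2 * length es + i) = (if edge_at es i \<in> C then 1 else 0))"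

text \<open>\<open>P\<close> solves a problem in time \<open>T m\<close> on connected graphs with \<open>m\<close> edges, where the problem
  prescribes the inputs \<open>k\<close> (\<open>Inst\<close>) and the correct outputs (\<open>Sol\<close>). The word length is
  only required to exceed the logarithm of the input size by a constant.\<close>

definition computes_in_time ::
  "prog \<Rightarrow> (nat \<Rightarrow> nat) \<Rightarrow> (nat set \<Rightarrow> nat set set \<Rightarrow> nat \<Rightarrow> bool) \<Rightarrow>
   (nat set \<Rightarrow> nat set set \<Rightarrow> nat \<Rightarrow> nat set set \<Rightarrow> bool) \<Rightarrow> bool" where
  "computes_in_time P T Inst Sol \<longleftrightarrow>
     (\<exists>c. \<forall>n E es k w.
        connected_graph {..<n} E \<and> edge_list es E \<and> Inst {..<n} E k \<and>
        c * (n + length es + 1) \<le> 2 ^ w \<longrightarrow>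
        (\<exists>t s C. exec w P (initial_config n es k) t s \<and> t \<le> T (card E) \<and>
                 Sol {..<n} E k C \<and> outputs es s C))"

end

theory Submission
  imports Defs
begin

text \<open>A shortest walk for the contracted lengths may be taken without repeated vertices. It visits
  each of the \<open>k/2\<close> vertices of \<open>S\<close> at most once, so it uses at most \<open>k\<close> edges incident to \<open>S\<close>, and its
  unit length exceeds its contracted length by at most \<open>k\<close>. The edges of the set \<open>C\<close>
  incident to \<open>S\<close> become loops, hence \<open>\<Phi> C \<ge> |C|\<close>. Each edge of \<open>C\<close> is counted at most twice in the degree sum of \<open>S\<close>,
  which is at least the fraction \<open>|S|/n\<close> of the total degree \<open>2m\<close>.

  The algorithm is a counting sort of the vertices by degree: its cost is \<open>O(n + m)\<close>, and connectedness
  gives \<open>n \<le> m + 1\<close>. A vertex is selected if and only if fewer than \<open>k/2\<close> vertices precede it in the order by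
  decreasing degree, ties being broken by the index.\<close>

section \<open>Walks\<close>

lemma walk_edges_append: "walk_edges (xs @ y # ys) = walk_edges (xs @ [y]) @ walk_edges (y # ys)"
  by (induction xs rule: walk_edges.induct) auto

lemma walk_edges_Cons: "p \<noteq> [] \<Longrightarrow> walk_edges (x # p) = {x, hd p} # walk_edges p"
  by (cases p) auto

text \<open>The first edge along which the walk leaves \<open>W\<close>; used to grow vertex sets in
  a connected graph.\<close>

lemma walk_crossing_edge:
  assumes "p \<noteq> []" "hd p \<in> W" "last p \<notin> W"
  shows "\<exists>x y. x \<in> W \<and> y \<notin> W \<and> y \<in> set p \<and> {x, y} \<in> set (walk_edges p)"
  using assms
proof (induction p rule: walk_edges.induct)
  case (1 x y p)
  show ?case
  proof (cases "y \<in> W")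
    case True
    then obtain a b where "a \<in> W" "b \<notin> W" "b \<in> set (y # p)" "{a, b} \<in> set (walk_edges (y # p))"
      using 1 by force
    then show ?thesis by (intro exI[of _ a] exI[of _ b]) simp
  next
    case False
    then show ?thesis using 1(3) by (intro exI[of _ x] exI[of _ y]) simp
  qed
qed auto

text \<open>Cutting out the closed walk between two visits to a vertex keeps both ends, and since
  lengths are nonnegative the total does not grow. The list gets shorter, so the induction
  terminates.\<close>

lemma distinct_walk_le:
  fixes l :: "'a set \<Rightarrow> real"
  assumes "p \<in> walks V E u v" and l: "\<And>e. l e \<ge> 0"
  shows "\<exists>q\<in>walks V E u v. distinct q \<and> sum_list (map l (walk_edges q)) \<le> sum_list (map l (walk_edges p))"
  using assms(1)
proof (induction p rule: length_induct)
  case (1 p)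
  show ?case
  proof (cases "distinct p")
    case False
    then obtain xs y ys zs where p: "p = xs @ y # ys @ y # zs"
      using not_distinct_decomp by force
    let ?q = "xs @ y # zs"
    have e: "walk_edges p = walk_edges (xs @ [y]) @ walk_edges (y # ys @ [y]) @ walk_edges (y # zs)"
      unfolding p using walk_edges_append[of xs y "ys @ y # zs"] walk_edges_append[of "y # ys" y zs]
      by simp
    have eq: "walk_edges ?q = walk_edges (xs @ [y]) @ walk_edges (y # zs)"
      by (rule walk_edges_append)
    have "set (walk_edges ?q) \<subseteq> set (walk_edges p)"
      unfolding e eq by auto
    moreover have "hd ?q = hd p" "last ?q = last p" "set ?q \<subseteq> set p"
      by (auto simp: p hd_append)
    ultimately have q: "?q \<in> walks V E u v"
      using 1(2) unfolding walks_def by auto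
    have "sum_list (map l (walk_edges (y # ys @ [y]))) \<ge> 0"
      by (rule sum_list_nonneg) (use l in auto)
    then have "sum_list (map l (walk_edges ?q)) \<le> sum_list (map l (walk_edges p))"
      unfolding e eq by simp
    moreover have "length ?q < length p" by (simp add: p)
    ultimately show ?thesis using 1(1) q by (meson order_trans)
  qed (use 1 in blast)
qed

text \<open>The summand for the head of the walk pays for the edge by which the walk is extended.\<close>

lemma incident_edges_of_walk_le:
  assumes "distinct p"
  shows "length (filter (\<lambda>e. e \<inter> S \<noteq> {}) (walk_edges p)) + (if p \<noteq> [] \<and> hd p \<in> S then 1 else 0)
    \<le> 2 * card (set p \<inter> S)"
  using assms
proof (induction p rule: walk_edges.induct)
  case (1 x y p)
  then show ?case by (cases "x \<in> S"; cases "y \<in> S") auto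
qed auto

text \<open>An infimum of reals is guaranteed to lie below the members only for sets bounded
  below.\<close>

lemma bdd_below_walk_lengths:
  fixes l :: "'a set \<Rightarrow> real"
  assumes "\<And>e. l e \<ge> 0"
  shows "bdd_below ((\<lambda>p. sum_list (map l (walk_edges p))) ` walks V E u v)"
  by (rule bdd_belowI2[of _ 0], rule sum_list_nonneg) (use assms in auto)

lemma incident_edges_contraction:
  assumes G: "connected_graph V E" and S: "S \<subseteq> V" "2 * card S \<le> k"
  shows "contraction V E k (incident_edges E S)"
  unfolding contraction_def
proof (intro conjI ballI)
  show "incident_edges E S \<subseteq> E" by (auto simp: incident_edges_def)
  fix u v assume uv: "u \<in> V" "v \<in> V"
  let ?l = "contracted_length (incident_edges E S)"
  have l: "?l e \<ge> 0" for e by (simp add: contracted_length_def)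
  have finS: "finite S"
    using G S(1) finite_subset by (auto simp: connected_graph_def simple_graph_def)
  have "graph_dist V E (\<lambda>_. 1) u v - real k \<le> graph_dist V E ?l u v"
    unfolding graph_dist_def[of V E ?l]
  \<comment> \<open>A lower bound for every walk is one for the infimum, which by connectedness
    ranges over a nonempty set.\<close>
  proof (rule cINF_greatest)
    show "walks V E u v \<noteq> {}" using G uv by (auto simp: connected_graph_def)
    fix p assume "p \<in> walks V E u v"
    then obtain q where q: "q \<in> walks V E u v" "distinct q"
      "sum_list (map ?l (walk_edges q)) \<le> sum_list (map ?l (walk_edges p))"
      using distinct_walk_le[of p V E u v ?l] l by blast
    have sub: "set (walk_edges q) \<subseteq> E" using q(1) by (auto simp: walks_def)
    \<comment> \<open>Unit and contracted length differ by one for each listed edge that meets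
      \<open>S\<close>.\<close>
    have "sum_list (map (\<lambda>_. 1) es) =
        sum_list (map ?l es) + real (length (filter (\<lambda>e. e \<inter> S \<noteq> {}) es))"
      if "set es \<subseteq> E" for es
      using that by (induction es) (auto simp: contracted_length_def incident_edges_def)
    note * = this[OF sub]
    have "length (filter (\<lambda>e. e \<inter> S \<noteq> {}) (walk_edges q)) \<le> 2 * card (set q \<inter> S)"
      using incident_edges_of_walk_le[OF q(2), of S] by linarith
    also have "\<dots> \<le> k" using S(2) card_mono[OF finS, of "set q \<inter> S"] by simp
    finally have "sum_list (map (\<lambda>_. 1) (walk_edges q)) - real k \<le> sum_list (map ?l (walk_edges p))"
      using * q(3) by linarith
    moreover have "graph_dist V E (\<lambda>_. 1) u v \<le> sum_list (map (\<lambda>_. 1) (walk_edges q))"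
      unfolding graph_dist_def by (rule cINF_lower[OF bdd_below_walk_lengths q(1)]) simp
    ultimately show "graph_dist V E (\<lambda>_. 1) u v - real k \<le> sum_list (map ?l (walk_edges p))"
      by linarith
  qed
  then show "graph_dist V E ?l u v \<ge> graph_dist V E (\<lambda>_. 1) u v - real k" .
qed

section \<open>Counting edges\<close>

lemma simple_graph_finite_edges: "simple_graph V E \<Longrightarrow> finite E"
  unfolding simple_graph_def by (meson PowI finite_Pow_iff finite_subset subsetI)

text \<open>Prepend \<open>u\<close> to a walk from \<open>v\<close>. Used in both directions, it
  shows that an edge of \<open>C\<close> joins vertices of one component.\<close>

lemma component_subset:
  assumes "{u, v} \<in> C" "u \<in> V"
  shows "component V C v \<subseteq> component V C u"
proof
  fix x assume "x \<in> component V C v"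
  then obtain p where "p \<in> walks V C v x" by (auto simp: component_def)
  then have "u # p \<in> walks V C u x" using assms by (auto simp: walks_def walk_edges_Cons)
  then show "x \<in> component V C u" by (auto simp: component_def)
qed

text \<open>Every edge of the contracted graph is the image of an edge outside \<open>C\<close>,
  because edges of \<open>C\<close> become loops.\<close>

lemma card_contracted_edges_le:
  assumes G: "simple_graph V E"
  shows "card (contracted_edges V E C) \<le> card (E - C)"
proof -
  have "contracted_edges V E C \<subseteq> (\<lambda>e. component V C ` e) ` (E - C)"
  proof
    fix X assume "X \<in> contracted_edges V E C"
    then obtain u v where uv: "X = {component V C u, component V C v}" "{u, v} \<in> E"
      "component V C u \<noteq> component V C v" by (auto simp: contracted_edges_def)
    have "u \<in> V" "v \<in> V" using uv(2) G by (auto simp: simple_graph_def)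
    then have "{u, v} \<in> E - C"
      using uv(2,3) component_subset[of u v C V] component_subset[of v u C V]
      by (auto simp: insert_commute)
    then show "X \<in> (\<lambda>e. component V C ` e) ` (E - C)"
      by (rule image_eqI[rotated]) (simp add: uv(1))
  qed
  then show ?thesis by (rule surj_card_le[rotated]) (simp add: simple_graph_finite_edges[OF G])
qed

lemma card_le_\<Phi>:
  assumes "simple_graph V E" "C \<subseteq> E"
  shows "real (card C) \<le> \<Phi> V E C"
proof -
  have "finite E" using simple_graph_finite_edges[OF assms(1)] .
  then have "card (E - C) = card E - card C" "card C \<le> card E"
    using assms(2) by (simp_all add: card_Diff_subset finite_subset card_mono)
  then show ?thesis using card_contracted_edges_le[OF assms(1), of C] by (simp add: \<Phi>_def)
qed

text \<open>Double counting of the incidences between \<open>S\<close> and \<open>E\<close>.\<close>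

lemma sum_degree:
  assumes "finite E" "finite S"
  shows "(\<Sum>s\<in>S. degree E s) = (\<Sum>e\<in>E. card (e \<inter> S))"
proof -
  have "(\<Sum>s\<in>S. degree E s) = (\<Sum>s\<in>S. \<Sum>e\<in>E. if s \<in> e then 1 else 0)"
    using assms by (simp add: degree_def flip: sum.inter_filter)
  also have "\<dots> = (\<Sum>e\<in>E. \<Sum>s\<in>S. if s \<in> e then 1 else 0)" by (rule sum.swap)
  also have "\<dots> = (\<Sum>e\<in>E. card (e \<inter> S))"
    using assms by (simp add: Int_def conj_commute flip: sum.inter_filter)
  finally show ?thesis .
qed

lemma sum_degree_le_incident:
  assumes G: "simple_graph V E" and S: "S \<subseteq> V"
  shows "(\<Sum>s\<in>S. degree E s) \<le> 2 * card (incident_edges E S)"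
proof -
  have fin: "finite E" "finite S"
    using simple_graph_finite_edges[OF G] G S finite_subset by (auto simp: simple_graph_def)
  have "card (e \<inter> S) \<le> (if e \<inter> S \<noteq> {} then 2 else 0)" if "e \<in> E" for e
  proof -
    have "card e = 2" using G that by (auto simp: simple_graph_def)
    moreover from this have "finite e" by (metis card.infinite zero_neq_numeral)
    ultimately show ?thesis using card_mono[of e "e \<inter> S"] by auto
  qed
  then have "(\<Sum>s\<in>S. degree E s) \<le> (\<Sum>e\<in>E. if e \<inter> S \<noteq> {} then 2 else 0)"
    unfolding sum_degree[OF fin] by (rule sum_mono)
  also have "\<dots> = 2 * card (incident_edges E S)"
    using fin by (simp add: incident_edges_def flip: sum.inter_filter)
  finally show ?thesis .
qed

lemma handshake:
  assumes G: "simple_graph V E"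
  shows "(\<Sum>v\<in>V. degree E v) = 2 * card E"
proof -
  have "(\<Sum>v\<in>V. degree E v) = (\<Sum>e\<in>E. card (e \<inter> V))"
    using G by (intro sum_degree simple_graph_finite_edges[OF G]) (auto simp: simple_graph_def)
  also have "\<dots> = (\<Sum>e\<in>E. 2)"
    using G by (intro sum.cong) (auto simp: simple_graph_def Int_absorb2)
  finally show ?thesis by simp
qed

text \<open>The average over a top set is at least the overall average, cross-multiplied to stay in
  the naturals. Summing \<open>f v \<le> f s\<close> over all pairs compares \<open>S\<close> with
  its complement; the contribution of \<open>S\<close> itself is the same on both sides.\<close>

lemma sum_top_ge_average:
  fixes f :: "'a \<Rightarrow> nat"
  assumes "finite V" "S \<subseteq> V" and top: "\<And>s v. s \<in> S \<Longrightarrow> v \<in> V - S \<Longrightarrow> f v \<le> f s"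
  shows "card S * (\<Sum>v\<in>V. f v) \<le> card V * (\<Sum>s\<in>S. f s)"
proof -
  have "card S * (\<Sum>v\<in>V - S. f v) = (\<Sum>s\<in>S. \<Sum>v\<in>V - S. f v)" by simp
  also have "\<dots> \<le> (\<Sum>s\<in>S. \<Sum>v\<in>V - S. f s)" by (intro sum_mono top)
  also have "\<dots> = card (V - S) * (\<Sum>s\<in>S. f s)" by (simp add: sum_distrib_left)
  finally have "card S * (\<Sum>v\<in>V - S. f v) \<le> card (V - S) * (\<Sum>s\<in>S. f s)" .
  moreover have "(\<Sum>v\<in>V. f v) = (\<Sum>v\<in>V - S. f v) + (\<Sum>s\<in>S. f s)"
    using assms(1,2) by (rule sum.subset_diff[rotated])
  moreover have "card V = card (V - S) + card S"
    using assms(1,2) by (metis card_Diff_subset card_mono finite_subset le_add_diff_inverse2)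
  ultimately show ?thesis by (simp add: algebra_simps)
qed

lemma \<Phi>_incident_edges_ge:
  assumes G: "connected_graph V E" and S: "highest_degree_vertices V E j S"
  shows "\<Phi> V E (incident_edges E S) \<ge> real j * real (card E) / real (card V)"
proof -
  have V: "simple_graph V E" "finite V" "V \<noteq> {}"
    using G by (auto simp: connected_graph_def simple_graph_def)
  have SV: "S \<subseteq> V" "card S = j" using S by (auto simp: highest_degree_vertices_def)
  have "j * (2 * card E) \<le> card V * (\<Sum>s\<in>S. degree E s)"
    using sum_top_ge_average[OF V(2) SV(1), of "degree E"] S SV(2) handshake[OF V(1)]
    by (auto simp: highest_degree_vertices_def)
  also have "\<dots> \<le> card V * (2 * card (incident_edges E S))"
    using sum_degree_le_incident[OF V(1) SV(1)] by simp
  \<comment> \<open>The 2 of the handshake lemma cancels against the 2 for edges with both ends in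
    \<open>S\<close>.\<close>
  finally have "j * card E \<le> card V * card (incident_edges E S)" by simp
  then have "real j * real (card E) \<le> real (card V) * real (card (incident_edges E S))"
    by (metis of_nat_le_iff of_nat_mult)
  moreover have "card V > 0" using V by (simp add: card_gt_0_iff)
  ultimately have "real j * real (card E) / real (card V) \<le> real (card (incident_edges E S))"
    by (simp add: divide_le_eq mult.commute)
  also have "\<dots> \<le> \<Phi> V E (incident_edges E S)"
    by (rule card_le_\<Phi>[OF V(1)]) (auto simp: incident_edges_def)
  finally show ?thesis .
qed

text \<open>Grow \<open>W\<close> one vertex at a time: a walk to a vertex outside \<open>W\<close>
  contains an edge leaving \<open>W\<close>, and adding its outer end gains that edge.\<close>

lemma connected_subgraph_growth:
  assumes G: "connected_graph V E" and j: "j < card V"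
  shows "\<exists>W\<subseteq>V. card W = Suc j \<and> j \<le> card {e \<in> E. e \<subseteq> W}"
  using j
proof (induction j)
  case 0
  then have "V \<noteq> {}" by auto
  then obtain v where "v \<in> V" by blast
  then show ?case by (intro exI[of _ "{v}"]) auto
next
  case (Suc j)
  then obtain W where W: "W \<subseteq> V" "card W = Suc j" "j \<le> card {e \<in> E. e \<subseteq> W}" by auto
  have finW: "finite W" "W \<noteq> {}" using W(2) card.infinite by force+
  have finE: "finite E" using G simple_graph_finite_edges by (auto simp: connected_graph_def)
  obtain u where u: "u \<in> W" using finW by blast
  have "W \<noteq> V" using Suc.prems W(2) by auto
  then obtain v where v: "v \<in> V" "v \<notin> W" using W(1) by blast
  obtain p where "p \<in> walks V E u v" using G u v W(1) unfolding connected_graph_def by blast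
  then obtain x y where xy: "x \<in> W" "y \<notin> W" "y \<in> V" "{x, y} \<in> E"
    using walk_crossing_edge[of p W] u v unfolding walks_def by blast
  \<comment> \<open>The edge is new since \<open>y\<close> lies outside \<open>W\<close>.\<close>
  have "Suc j \<le> card (insert {x, y} {e \<in> E. e \<subseteq> W})"
    using W(3) finE xy by (subst card_insert_disjoint) auto
  also have "\<dots> \<le> card {e \<in> E. e \<subseteq> insert y W}"
    using finE xy by (intro card_mono) auto
  finally show ?case
    using W xy finW by (intro exI[of _ "insert y W"]) auto
qed

text \<open>Turns a running time linear in \<open>n + m\<close> into one linear in
  \<open>m\<close>.\<close>

lemma connected_card_vertices_le:
  assumes G: "connected_graph V E"
  shows "card V \<le> Suc (card E)"
proof (cases "card V")
  case (Suc j)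
  then obtain W where "j \<le> card {e \<in> E. e \<subseteq> W}"
    using connected_subgraph_growth[OF G, of j] by auto
  also have "\<dots> \<le> card E"
    using G by (intro card_mono) (auto simp: connected_graph_def dest: simple_graph_finite_edges)
  finally show ?thesis using Suc by simp
qed simp

section \<open>Reasoning about programs\<close>

text \<open>Total correctness: one halting run with a good result suffices, since by
  \<open>exec_deterministic\<close> it is the only one. The postcondition also sees the step
  count.\<close>

definition wp :: "nat \<Rightarrow> prog \<Rightarrow> (nat \<Rightarrow> config \<Rightarrow> bool) \<Rightarrow> config \<Rightarrow> bool" where
  "wp w P Q s \<longleftrightarrow> (\<exists>t s'. exec w P s t s' \<and> Q t s')"

lemma wp_mono: "wp w P Q s \<Longrightarrow> (\<And>t s'. Q t s' \<Longrightarrow> Q' t s') \<Longrightarrow> wp w P Q' s"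
  unfolding wp_def by blast

text \<open>Here and in \<open>wp_Add\<close> the absence of overflow is a premise, so the
  simplifier executes the instruction only after proving that the value fits.\<close>

lemma wp_Set [simp]: "a < 2 ^ w \<Longrightarrow> wp w (Set x a) Q (R, M) \<longleftrightarrow> Q 1 (R(x := a), M)"
  unfolding wp_def One_nat_def by (blast elim: exec_SetE intro: exec.Set[unfolded One_nat_def])

lemma wp_Add [simp]: "R y + R z < 2 ^ w \<Longrightarrow> wp w (Add x y z) Q (R, M) \<longleftrightarrow> Q 1 (R(x := R y + R z), M)"
  unfolding wp_def One_nat_def by (blast elim: exec_AddE intro: exec.Add[unfolded One_nat_def])

lemma wp_Sub [simp]: "wp w (Sub x y z) Q (R, M) \<longleftrightarrow> Q 1 (R(x := R y - R z), M)"
  unfolding wp_def One_nat_def by (blast elim: exec_SubE intro: exec.Sub[unfolded One_nat_def])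

lemma wp_Load [simp]: "wp w (Load x y) Q (R, M) \<longleftrightarrow> Q 1 (R(x := M (R y)), M)"
  unfolding wp_def One_nat_def by (blast elim: exec_LoadE intro: exec.Load[unfolded One_nat_def])

lemma wp_Store [simp]: "wp w (Store x y) Q (R, M) \<longleftrightarrow> Q 1 (R, M(R x := R y))"
  unfolding wp_def One_nat_def by (blast elim: exec_StoreE intro: exec.Store[unfolded One_nat_def])

lemma wp_Skip [simp]: "wp w Skip Q (R, M) \<longleftrightarrow> Q 1 (R, M)"
  unfolding wp_def One_nat_def by (blast elim: exec_SkipE intro: exec.Skip[unfolded One_nat_def])

lemma wp_Seq [simp]: "wp w (Seq P P') Q s \<longleftrightarrow> wp w P (\<lambda>t. wp w P' (\<lambda>t'. Q (t + t'))) s"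
  unfolding wp_def by (blast elim: exec_SeqE intro: exec.Seq)

lemma wp_IfLess [simp]:
  "wp w (IfLess x y P P') Q (R, M) \<longleftrightarrow>
     (if R x < R y then wp w P (\<lambda>t. Q (Suc t)) (R, M) else wp w P' (\<lambda>t. Q (Suc t)) (R, M))"
  unfolding wp_def by (cases "R x < R y") (simp, blast elim: exec_IfE intro: exec.IfTrue exec.IfFalse)+

definition triple :: "nat \<Rightarrow> (config \<Rightarrow> bool) \<Rightarrow> prog \<Rightarrow> nat \<Rightarrow> (config \<Rightarrow> bool) \<Rightarrow> bool" where
  "triple w A P b B \<longleftrightarrow> (\<forall>s. A s \<longrightarrow> wp w P (\<lambda>t s'. t \<le> b \<and> B s') s)"

lemma triple_Seq: "triple w A P b B \<Longrightarrow> triple w B P' b' C \<Longrightarrow> triple w A (Seq P P') (b + b') C"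
  unfolding triple_def wp_Seq by (fastforce elim!: wp_mono intro: add_mono)

lemma triple_conseq:
  "triple w A P b B \<Longrightarrow> (\<And>s. A' s \<Longrightarrow> A s) \<Longrightarrow> b \<le> b' \<Longrightarrow> (\<And>s. B s \<Longrightarrow> B' s) \<Longrightarrow> triple w A' P b' B'"
  unfolding triple_def by (fastforce elim!: wp_mono)

text \<open>Fixing the initial configuration lets a postcondition refer to it, and allows
  existential quantifiers in the precondition to be eliminated first.\<close>

lemma triple_pointwise: "(\<And>s. A s \<Longrightarrow> triple w (\<lambda>s'. s' = s) P b B) \<Longrightarrow> triple w A P b B"
  unfolding triple_def by blast

text \<open>Rule for loops with a known number \<open>N\<close> of rounds; the invariant is indexed
  by the rounds done. Each round costs its body plus a test, and the last, failing test costs one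
  more.\<close>

lemma triple_While:
  assumes step: "\<And>i R M. i < N \<Longrightarrow> I i (R, M) \<Longrightarrow>
      R x < R y \<and> wp w P (\<lambda>t s'. t \<le> c \<and> I (Suc i) s') (R, M)"
    and stop: "\<And>R M. I N (R, M) \<Longrightarrow> \<not> R x < R y"
  shows "triple w (I 0) (WhileLess x y P) (Suc (N * Suc c)) (I N)"
proof -
  \<comment> \<open>Induction on the number \<open>j\<close> of rounds still to come.\<close>
  have "wp w (WhileLess x y P) (\<lambda>t s'. t \<le> Suc (j * Suc c) \<and> I N s') s"
    if "I (N - j) s" "j \<le> N" for j s
    using that
  proof (induction j arbitrary: s)
    case 0
    obtain R M where s: "s = (R, M)" by (cases s)
    with 0 stop have "exec w (WhileLess x y P) s 1 s" by (simp add: exec.WhileFalse del: One_nat_def)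
    with 0 show ?case unfolding wp_def by (intro exI[of _ 1] exI[of _ s]) simp
  next
    case (Suc j)
    obtain R M where s: "s = (R, M)" by (cases s)
    have N: "N - Suc j < N" "Suc (N - Suc j) = N - j" using Suc.prems(2) by auto
    with step[of "N - Suc j" R M] Suc.prems obtain t s1 where
      R: "R x < R y" and 1: "exec w P (R, M) t s1" "t \<le> c" "I (N - j) s1"
      by (auto simp: wp_def s)
    from Suc.IH[OF 1(3)] Suc.prems(2) obtain t' s2 where
      2: "exec w (WhileLess x y P) s1 t' s2" "t' \<le> Suc (j * Suc c)" "I N s2"
      by (auto simp: wp_def)
    have "exec w (WhileLess x y P) s (Suc (t + t')) s2"
      unfolding s by (rule exec.WhileTrue[OF R 1(1) 2(1)])
    moreover have "Suc (t + t') \<le> Suc (Suc j * Suc c)" using 1(2) 2(2) by simp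
    ultimately show ?case using 2(3) unfolding wp_def by blast
  qed
  from this[of N] show ?thesis unfolding triple_def by simp
qed

section \<open>The program\<close>

text \<open>\<open>histogram y b\<close> increments the cell at \<open>R b + x\<close> for every word \<open>x\<close> stored between the
  addresses in register 9 and in register \<open>y\<close>.\<close>

definition histogram :: "nat \<Rightarrow> nat \<Rightarrow> prog" where
  "histogram y b = WhileLess 9 y
     (Seq (Load 10 9) (Seq (Add 10 10 b) (Seq (Load 11 10) (Seq (Add 11 11 1)
     (Seq (Store 10 11) (Add 9 9 1))))))"

text \<open>The table starts after the last word of \<open>xs\<close>, so increments never alter
  words yet to be read. Describing all of memory also records what stays unchanged.\<close>

lemma triple_histogram:
  fixes xs :: "nat list"
  assumes R: "R 9 = p" "R y = p + length xs" "R b = q" "R 1 = 1" "y \<notin> {9, 10, 11}" "b \<notin> {9, 10, 11}"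
    and M: "\<And>i. i < length xs \<Longrightarrow> M (p + i) = xs ! i" "\<And>x. x \<in> set xs \<Longrightarrow> M (q + x) = 0"
    and q: "p + length xs \<le> q" "\<And>x. x \<in> set xs \<Longrightarrow> q + x < 2 ^ w" "q < 2 ^ w"
  shows "triple w (\<lambda>s. s = (R, M)) (histogram y b) (Suc (length xs * 7))
    (\<lambda>(R', M'). (\<forall>r. r \<notin> {9, 10, 11} \<longrightarrow> R' r = R r) \<and>
       (\<forall>a. M' a = M a + (if q \<le> a then count_list xs (a - q) else 0)))"
proof -
  define h where "h i a = M a + (if q \<le> a then count_list (take i xs) (a - q) else 0)" for i a
  define I where "I i = (\<lambda>(R', M'). (\<forall>r. r \<notin> {9, 10, 11} \<longrightarrow> R' r = R r) \<and> R' 9 = p + i \<and> M' = h i)" for i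
  have "triple w (I 0) (histogram y b) (Suc (length xs * Suc 6)) (I (length xs))"
    unfolding histogram_def
  proof (rule triple_While)
    fix i R' M' assume i: "i < length xs" and "I i (R', M')"
    then have r: "\<And>r. r \<notin> {9, 10, 11} \<Longrightarrow> R' r = R r" "R' 9 = p + i"
      and m: "M' = h i"
      by (auto simp: I_def)
    have r': "R' y = p + length xs" "R' b = q" "R' (Suc 0) = 1" using r(1) R by auto
    have Mi: "M' (p + i) = xs ! i" using M(1)[OF i] q(1) i by (auto simp: m h_def)
    have Mx: "M' (q + xs ! i) = count_list (take i xs) (xs ! i)"
      using M(2)[of "xs ! i"] i by (simp add: m h_def)
    \<comment> \<open>A counter is at most the number of words read, so
      \<open>p + length xs \<le> q < 2 ^ w\<close> keeps counter and pointer from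
      overflowing.\<close>
    have "count_list (take i xs) (xs ! i) \<le> i"
      using count_le_length[of "take i xs" "xs ! i"] i by simp
    then have b1: "Suc (count_list (take i xs) (xs ! i)) < 2 ^ w" "Suc (p + i) < 2 ^ w"
      using q(1,3) i by linarith+
    have b2: "xs ! i + q < 2 ^ w" using q(2)[of "xs ! i"] i by (simp add: add.commute)
    have upd: "M'(q + xs ! i := Suc (count_list (take i xs) (xs ! i))) = h (Suc i)"
      using i Mx M(2)[of "xs ! i"] by (auto simp: m h_def take_Suc_conv_app_nth)
    show "R' 9 < R' y \<and> wp w (Seq (Load 10 9) (Seq (Add 10 10 b) (Seq (Load 11 10)
        (Seq (Add 11 11 1) (Seq (Store 10 11) (Add 9 9 1)))))) (\<lambda>t s'. t \<le> 6 \<and> I (Suc i) s') (R', M')"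
      using i R(5,6) r r' b1 b2
      by (simp add: I_def Mi Mx upd add.commute[of "xs ! i"])
  next
    fix R' M' assume "I (length xs) (R', M')"
    then show "\<not> R' 9 < R' y" using R by (auto simp: I_def)
  qed
  then show ?thesis
    by (rule triple_conseq) (use R in \<open>auto simp: I_def h_def\<close>)
qed

text \<open>Registers 0 and 1 hold the constants 0 and 1, which are also the addresses of
  \<open>n\<close> and \<open>m\<close>. Registers 6, 7 and 8 receive the start addresses of the
  output, vertex and degree tables, which follow the input consecutively.\<close>

definition load_input :: prog where
  "load_input = Seq (Set 1 1) (Seq (Load 2 0) (Seq (Load 3 1) (Seq (Set 5 2) (Seq (Load 4 5)
     (Seq (Set 9 3) (Seq (Add 6 3 3) (Seq (Add 6 6 9) (Seq (Add 7 6 3) (Add 8 7 2)))))))))"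

text \<open>There is no division instruction: register 12 counts up until its double in register 13
  reaches \<open>k\<close>.\<close>

definition halve :: prog where
  "halve = WhileLess 13 4 (Seq (Add 12 12 1) (Add 13 12 12))"

text \<open>Scans the degrees downwards and replaces the number of vertices of degree \<open>d\<close> by the number
  of vertices of degree at most \<open>d\<close> that may still be selected.\<close>

definition budgets :: prog where
  "budgets = WhileLess 8 9 (Seq (Sub 9 9 1) (Seq (Load 10 9) (Seq (Store 9 12) (Sub 12 12 10))))"

text \<open>Replaces the degree of each vertex by a mark telling whether the vertex is selected.\<close>

definition mark :: prog where
  "mark = WhileLess 9 8 (Seq (Load 10 9) (Seq (Add 10 10 8) (Seq (Load 11 10)
     (Seq (IfLess 0 11 (Seq (Sub 11 11 1) (Seq (Store 10 11) (Store 9 1))) (Store 9 0))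
       (Add 9 9 1)))))"

text \<open>An edge is marked if the sum of the marks of its ends is positive. Otherwise its output
  cell keeps the initial 0.\<close>

definition emit :: prog where
  "emit = WhileLess 9 6 (Seq (Load 10 9) (Seq (Add 10 10 7) (Seq (Load 10 10) (Seq (Add 9 9 1)
     (Seq (Load 11 9) (Seq (Add 11 11 7) (Seq (Load 11 11) (Seq (Add 9 9 1)
     (Seq (Add 10 10 11) (Seq (IfLess 0 10 (Store 13 1) Skip) (Add 13 13 1)))))))))))"

text \<open>Adding register 0 copies a register. In \<open>histogram 8 8\<close>, register 8 is both
  the end of the degrees to be read and the start of the table of their frequencies.\<close>

definition top_degree_edges :: prog where
  "top_degree_edges = Seq load_input (Seq (histogram 6 7) (Seq (Add 9 7 0) (Seq (histogram 8 8)
     (Seq halve (Seq (Seq (Add 9 8 3) (Seq (Add 9 9 3) (Add 9 9 1))) (Seq budgets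
     (Seq (Add 9 7 0) (Seq mark (Seq (Seq (Set 9 3) (Add 13 6 0)) emit)))))))))"

section \<open>The list of edge endpoints\<close>

definition endpoints :: "(nat \<times> nat) list \<Rightarrow> nat list" where
  "endpoints es = concat (map (\<lambda>(u, v). [u, v]) es)"

lemma length_endpoints [simp]: "length (endpoints es) = 2 * length es"
  by (induction es) (auto simp: endpoints_def)

lemma nth_endpoints:
  assumes "i < length es"
  shows "endpoints es ! (2 * i) = fst (es ! i)" "endpoints es ! Suc (2 * i) = snd (es ! i)"
proof -
  have "endpoints es ! (2 * i) = fst (es ! i) \<and> endpoints es ! Suc (2 * i) = snd (es ! i)"
    using assms
  proof (induction es arbitrary: i)
    case (Cons e es)
    then show ?case by (cases i; cases e) (auto simp: endpoints_def)
  qed simp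
  then show "endpoints es ! (2 * i) = fst (es ! i)" "endpoints es ! Suc (2 * i) = snd (es ! i)"
    by auto
qed

lemma set_endpoints: "set (endpoints es) = (\<Union>i<length es. edge_at es i)"
  by (induction es) (auto simp: endpoints_def edge_at_def lessThan_Suc_eq_insert_0 split: prod.splits)

lemma count_list_map_upt: "count_list (map f [0..<n]) x = card {v. v < n \<and> f v = x}"
proof (induction n)
  case (Suc n)
  have "{v. v < Suc n \<and> f v = x} = {v. v < n \<and> f v = x} \<union> (if f n = x then {n} else {})"
    by (auto simp: less_Suc_eq)
  with Suc show ?case by (auto simp: card_insert_if)
qed simp

section \<open>Correctness and step counts of the phases\<close>

locale instance_on_word_RAM =
  fixes n k w :: nat and es :: "(nat \<times> nat) list"
  assumes word_length: "10 * (n + length es + 1) \<le> 2 ^ w"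
    and endpoints: "set (endpoints es) \<subseteq> {..<n}"
    and k_le: "k \<le> n" and even_k: "even k"
begin

abbreviation "m \<equiv> length es"
abbreviation "deg \<equiv> count_list (endpoints es)"

text \<open>\<open>X\<close> is the output table, indexed by edges. The table \<open>D\<close> is indexed by vertices and holds first
  the degrees, then the marks. The table \<open>C\<close> is indexed by degrees, for which the bound \<open>2 * m\<close>
  needs no appeal to simplicity of the graph.\<close>

definition layout :: "(nat \<Rightarrow> nat) \<Rightarrow> (nat \<Rightarrow> nat) \<Rightarrow> (nat \<Rightarrow> nat) \<Rightarrow> (nat \<Rightarrow> nat) \<Rightarrow> bool" where
  "layout X D C M \<longleftrightarrow>
     (\<forall>i<2 * m. M (3 + i) = endpoints es ! i) \<and> (\<forall>i<m. M (3 + 2 * m + i) = X i) \<and>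
     (\<forall>v<n. M (3 + 3 * m + v) = D v) \<and> (\<forall>d\<le>2 * m. M (3 + 3 * m + n + d) = C d)"

definition regs :: "(nat \<Rightarrow> nat) \<Rightarrow> bool" where
  "regs R \<longleftrightarrow> R 0 = 0 \<and> R 1 = 1 \<and> R 3 = m \<and> R 6 = 3 + 2 * m \<and> R 7 = 3 + 3 * m \<and> R 8 = 3 + 3 * m + n"

definition at_least :: "nat \<Rightarrow> nat" where
  "at_least d = card {v. v < n \<and> d \<le> deg v}"

text \<open>The position, from 0, by decreasing degree and then by index. The program handles the
  summands separately: the first reduces the budget of a degree, the second is the number of
  vertices of that degree scanned earlier.\<close>

definition rank :: "nat \<Rightarrow> nat" where
  "rank v = at_least (Suc (deg v)) + card {u. u < v \<and> deg u = deg v}"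

text \<open>The bound is \<open>10 * (n + m + 1) - 1\<close>. The largest address used is one past
  the degree table, \<open>4 + 5 * m + n\<close>.\<close>

lemma fits: "x \<le> 9 + 10 * n + 10 * m \<Longrightarrow> x < 2 ^ w"
  by (rule less_le_trans[OF _ word_length]) simp

lemma deg_le: "deg v \<le> 2 * m"
  using count_le_length[of "endpoints es" v] by simp

lemma layout_update_C:
  assumes "layout X D C M" "d \<le> 2 * m" "a = 3 + 3 * m + n + d" "\<And>e. C' e = (if e = d then x else C e)"
  shows "layout X D C' (M(a := x))"
  using assms by (auto simp: layout_def)

lemma layout_update_D:
  assumes "layout X D C M" "v < n" "a = 3 + 3 * m + v" "\<And>u. D' u = (if u = v then x else D u)"
  shows "layout X D' C (M(a := x))"
  using assms by (auto simp: layout_def)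

lemma layout_update_X:
  assumes "layout X D C M" "i < m" "a = 3 + 2 * m + i" "\<And>e. X' e = (if e = i then x else X e)"
  shows "layout X' D C (M(a := x))"
  using assms by (auto simp: layout_def)

lemma triple_load_input:
  "triple w (\<lambda>s. s = initial_config n es k) load_input 10
     (\<lambda>(R, M). regs R \<and> R 4 = k \<and> R 9 = 3 \<and> R 12 = 0 \<and> R 13 = 0 \<and>
        layout (\<lambda>_. 0) (\<lambda>_. 0) (\<lambda>_. 0) M)"
proof -
  have e: "concat (map (\<lambda>(u, v). [u, v]) es) = endpoints es" by (simp add: endpoints_def)
  have "(3::nat) < 2 ^ w" "(2::nat) < 2 ^ w" "Suc 0 < 2 ^ w" "3 + 3 * m + n < 2 ^ w"
    by (auto intro!: fits)
  then show ?thesis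
    by (simp add: triple_def load_input_def initial_config_def input_words_def regs_def layout_def e
        nth_Cons' eval_nat_numeral)
qed

lemma triple_degrees:
  "triple w (\<lambda>(R, M). regs R \<and> R 4 = k \<and> R 9 = 3 \<and> R 12 = 0 \<and> R 13 = 0 \<and>
        layout (\<lambda>_. 0) (\<lambda>_. 0) (\<lambda>_. 0) M)
     (histogram 6 7) (Suc (2 * m * 7))
     (\<lambda>(R, M). regs R \<and> R 4 = k \<and> R 12 = 0 \<and> R 13 = 0 \<and> layout (\<lambda>_. 0) deg (\<lambda>_. 0) M)"
proof (rule triple_pointwise, clarify)
  fix R M assume R: "regs R" "k = R 4" "R 9 = 3" "R 12 = 0" "R 13 = 0"
    and M: "layout (\<lambda>_. 0) (\<lambda>_. 0) (\<lambda>_. 0) M"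
  have ends: "x < n" if "x \<in> set (endpoints es)" for x using endpoints that by auto
  \<comment> \<open>The degree table lies at offset \<open>n\<close> of the histogram and stays 0
    because all endpoints are below \<open>n\<close>.\<close>
  have zero: "deg (n + d) = 0" for d using ends[of "n + d"] by (auto simp: count_list_0_iff)
  have "triple w (\<lambda>s. s = (R, M)) (histogram 6 7) (Suc (length (endpoints es) * 7))
    (\<lambda>(R', M'). (\<forall>r. r \<notin> {9, 10, 11} \<longrightarrow> R' r = R r) \<and>
       (\<forall>a. M' a = M a + (if 3 + 3 * m \<le> a then deg (a - (3 + 3 * m)) else 0)))"
  proof (rule triple_histogram)
    show "R 9 = 3" "R 6 = 3 + length (endpoints es)" "R 7 = 3 + 3 * m" "R 1 = 1"
      "(6::nat) \<notin> {9, 10, 11}" "(7::nat) \<notin> {9, 10, 11}"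
      using R by (auto simp: regs_def)
    show "M (3 + i) = endpoints es ! i" if "i < length (endpoints es)" for i
      using that M by (auto simp: layout_def)
    fix x assume "x \<in> set (endpoints es)"
    then have x: "x < n" by (rule ends)
    then show "M (3 + 3 * m + x) = 0" using M by (auto simp: layout_def)
    show "3 + 3 * m + x < 2 ^ w" using x by (auto intro!: fits)
  next
    show "3 + 3 * m < 2 ^ w" "3 + length (endpoints es) \<le> 3 + 3 * m" by (auto intro!: fits)
  qed
  then show "triple w (\<lambda>s'. s' = (R, M)) (histogram 6 7) (Suc (2 * m * 7))
     (\<lambda>(R', M). regs R' \<and> R' 4 = R 4 \<and> R' 12 = 0 \<and> R' 13 = 0 \<and> layout (\<lambda>_. 0) deg (\<lambda>_. 0) M)"
  proof (rule triple_conseq, goal_cases)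
    case (3 s)
    then show ?case using R M by (cases s) (auto simp: regs_def layout_def zero)
  qed auto
qed

lemma triple_degree_counts:
  "triple w (\<lambda>(R, M). regs R \<and> R 4 = k \<and> R 9 = 3 + 3 * m \<and> R 12 = 0 \<and> R 13 = 0 \<and>
        layout (\<lambda>_. 0) deg (\<lambda>_. 0) M)
     (histogram 8 8) (Suc (n * 7))
     (\<lambda>(R, M). regs R \<and> R 4 = k \<and> R 12 = 0 \<and> R 13 = 0 \<and>
        layout (\<lambda>_. 0) deg (\<lambda>d. card {v. v < n \<and> deg v = d}) M)"
proof (rule triple_pointwise, clarify)
  fix R M assume R: "regs R" "k = R 4" "R 9 = 3 + 3 * m" "R 12 = 0" "R 13 = 0"
    and M: "layout (\<lambda>_. 0) deg (\<lambda>_. 0) M"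
  have "triple w (\<lambda>s. s = (R, M)) (histogram 8 8) (Suc (length (map deg [0..<n]) * 7))
    (\<lambda>(R', M'). (\<forall>r. r \<notin> {9, 10, 11} \<longrightarrow> R' r = R r) \<and>
       (\<forall>a. M' a = M a + (if 3 + 3 * m + n \<le> a
          then count_list (map deg [0..<n]) (a - (3 + 3 * m + n)) else 0)))"
  proof (rule triple_histogram)
    show "R 9 = 3 + 3 * m" "R 8 = 3 + 3 * m + length (map deg [0..<n])" "R 8 = 3 + 3 * m + n"
      "R 1 = 1" "(8::nat) \<notin> {9, 10, 11}" "(8::nat) \<notin> {9, 10, 11}"
      using R by (auto simp: regs_def)
    show "M (3 + 3 * m + i) = map deg [0..<n] ! i" if "i < length (map deg [0..<n])" for i
      using that M by (auto simp: layout_def)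
    fix x assume "x \<in> set (map deg [0..<n])"
    then have x: "x \<le> 2 * m" using deg_le by auto
    then show "M (3 + 3 * m + n + x) = 0" using M by (auto simp: layout_def)
    show "3 + 3 * m + n + x < 2 ^ w" using x by (auto intro!: fits)
  next
    show "3 + 3 * m + n < 2 ^ w" "3 + 3 * m + length (map deg [0..<n]) \<le> 3 + 3 * m + n"
      by (auto intro!: fits)
  qed
  then show "triple w (\<lambda>s'. s' = (R, M)) (histogram 8 8) (Suc (n * 7))
     (\<lambda>(R', M). regs R' \<and> R' 4 = R 4 \<and> R' 12 = 0 \<and> R' 13 = 0 \<and>
        layout (\<lambda>_. 0) deg (\<lambda>d. card {v. v < n \<and> deg v = d}) M)"
  proof (rule triple_conseq, goal_cases)
    case (3 s)
    then show ?case using R M by (cases s) (auto simp: regs_def layout_def count_list_map_upt)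
  qed auto
qed

lemma triple_halve:
  "triple w (\<lambda>(R, M). regs R \<and> R 4 = k \<and> R 12 = 0 \<and> R 13 = 0 \<and> layout X D C M)
     halve (Suc (k div 2 * 3)) (\<lambda>(R, M). regs R \<and> R 12 = k div 2 \<and> layout X D C M)"
proof -
  define I where "I i = (\<lambda>(R, M). regs R \<and> R 4 = k \<and> R 12 = i \<and> R 13 = 2 * i \<and> layout X D C M)" for i
  have "triple w (I 0) halve (Suc (k div 2 * Suc 2)) (I (k div 2))"
    unfolding halve_def
  proof (rule triple_While)
    fix i R M assume i: "i < k div 2" and I: "I i (R, M)"
    have "2 * i < k" using i by linarith
    moreover have "Suc i < 2 ^ w" "Suc i + Suc i < 2 ^ w" using i k_le by (auto intro!: fits)
    ultimately show "R 13 < R 4 \<and> wp w (Seq (Add 12 12 1) (Add 13 12 12)) (\<lambda>t s'. t \<le> 2 \<and> I (Suc i) s') (R, M)"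
      using I by (simp add: I_def regs_def)
  \<comment> \<open>For even \<open>k\<close> the doubled counter equals \<open>k\<close> after
    \<open>k div 2\<close> rounds.\<close>
  qed (use even_k in \<open>auto simp: I_def\<close>)
  then show ?thesis by (rule triple_conseq) (auto simp: I_def)
qed

lemma at_least_split: "at_least d = at_least (Suc d) + card {v. v < n \<and> deg v = d}"
proof -
  let ?A = "{v. v < n \<and> Suc d \<le> deg v}" and ?B = "{v. v < n \<and> deg v = d}"
  have "{v. v < n \<and> d \<le> deg v} = ?A \<union> ?B" by auto
  moreover have "card (?A \<union> ?B) = card ?A + card ?B" by (rule card_Un_disjoint) auto
  ultimately show ?thesis unfolding at_least_def by (simp only:)
qed

text \<open>Going down from the largest degree, register 12 loses the frequency of each degree
  passed. Truncated subtraction keeps it at 0 once the budget is spent.\<close>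

lemma triple_budgets:
  "triple w (\<lambda>(R, M). regs R \<and> R 9 = 3 + 3 * m + n + (2 * m + 1) \<and> R 12 = j \<and>
        layout X D (\<lambda>d. card {v. v < n \<and> deg v = d}) M)
     budgets (Suc ((2 * m + 1) * 5)) (\<lambda>(R, M). regs R \<and> layout X D (\<lambda>d. j - at_least (Suc d)) M)"
proof -
  let ?N = "2 * m + 1"
  define C where "C i d = (if ?N - i \<le> d then j - at_least (Suc d) else card {v. v < n \<and> deg v = d})" for i d
  define I where "I i = (\<lambda>(R, M). regs R \<and> R 9 = 3 + 3 * m + n + (?N - i) \<and>
    R 12 = j - at_least (?N - i) \<and> layout X D (C i) M)" for i
  have "triple w (I 0) budgets (Suc (?N * Suc 4)) (I ?N)"
    unfolding budgets_def
  proof (rule triple_While)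
    fix i R M assume i: "i < ?N" and I: "I i (R, M)"
    define d where "d = 2 * m - i"
    have d: "?N - i = Suc d" "?N - Suc i = d" "d \<le> 2 * m" using i by (auto simp: d_def)
    have R: "regs R" "R 9 = Suc (3 + 3 * m + n + d)" "R 12 = j - at_least (Suc d)"
      and M: "layout X D (C i) M" using I d by (auto simp: I_def)
    have Md: "M (3 + 3 * m + n + d) = card {v. v < n \<and> deg v = d}"
      using M d by (auto simp: layout_def C_def)
    have "layout X D (C (Suc i)) (M(3 + 3 * m + n + d := j - at_least (Suc d)))"
      by (rule layout_update_C[OF M d(3) refl]) (unfold C_def d, auto)
    moreover have "I (Suc i) = (\<lambda>(R, M). regs R \<and> R 9 = 3 + 3 * m + n + d \<and>
        R 12 = j - at_least d \<and> layout X D (C (Suc i)) M)"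
      unfolding I_def d ..
    ultimately show "R 8 < R 9 \<and> wp w (Seq (Sub 9 9 1) (Seq (Load 10 9) (Seq (Store 9 12) (Sub 12 12 10))))
        (\<lambda>t s'. t \<le> 4 \<and> I (Suc i) s') (R, M)"
      using R Md by (simp add: regs_def at_least_split[of d] add.assoc)
  qed (auto simp: I_def regs_def)
  \<comment> \<open>No degree exceeds \<open>2 * m\<close>, so the scan starts with the full budget
    \<open>j\<close>.\<close>
  moreover have "at_least ?N = 0"
    using deg_le by (auto simp: at_least_def card_eq_0_iff not_le less_Suc_eq_le)
  ultimately show ?thesis
    by - (rule triple_conseq, assumption, auto simp: I_def layout_def C_def)
qed

lemma triple_mark:
  "triple w (\<lambda>(R, M). regs R \<and> R 9 = 3 + 3 * m \<and> layout X deg (\<lambda>d. j - at_least (Suc d)) M)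
     mark (Suc (n * 9)) (\<lambda>(R, M). regs R \<and> (\<exists>C. layout X (\<lambda>v. of_bool (rank v < j)) C M))"
proof -
  define D where "D i v = (if v < i then of_bool (rank v < j) else deg v)" for i v
  define C where "C i d = j - at_least (Suc d) - card {u. u < i \<and> deg u = d}" for i d
  define I where "I i = (\<lambda>(R, M). regs R \<and> R 9 = 3 + 3 * m + i \<and> layout X (D i) (C i) M)" for i
  have "triple w (I 0) mark (Suc (n * Suc 8)) (I n)"
    unfolding mark_def
  proof (rule triple_While)
    fix i R M assume i: "i < n" and I: "I i (R, M)"
    let ?b = "3 + 3 * m + n" and ?body = "Seq (Load 10 9) (Seq (Add 10 10 8) (Seq (Load 11 10)
     (Seq (IfLess 0 11 (Seq (Sub 11 11 1) (Seq (Store 10 11) (Store 9 1))) (Store 9 0))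
       (Add 9 9 1))))"
    have R: "regs R" "R 9 = 3 + 3 * m + i" and M: "layout X (D i) (C i) M"
      using I by (auto simp: I_def)
    have Mi: "M (3 + 3 * m + i) = deg i" using M i by (simp add: layout_def D_def)
    have Md: "M (?b + deg i) = C i (deg i)" using M deg_le by (simp add: layout_def)
    have bound: "?b + deg i < 2 ^ w" "Suc (3 + 3 * m + i) < 2 ^ w"
      using deg_le[of i] i by (auto intro!: fits)
    \<comment> \<open>The two numbers subtracted from \<open>j\<close> add up to
      \<open>rank i\<close>, so the truncated difference is positive exactly if
      \<open>rank i < j\<close>.\<close>
    have pos: "0 < C i (deg i) \<longleftrightarrow> rank i < j" by (auto simp: C_def rank_def)
    have "{u. u < Suc i \<and> deg u = d} = {u. u < i \<and> deg u = d} \<union> (if deg i = d then {i} else {})" for d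
      by (auto simp: less_Suc_eq)
    then have CSuc: "C (Suc i) d = (if d = deg i then C i d - 1 else C i d)" for d
      by (auto simp: C_def card_insert_if)
    have DSuc: "D (Suc i) u = (if u = i then of_bool (rank i < j) else D i u)" for u
      by (auto simp: D_def)
    have "wp w ?body (\<lambda>t s'. t \<le> 8 \<and> I (Suc i) s') (R, M)"
    proof (cases "rank i < j")
      case True
      have "layout X (D (Suc i)) (C (Suc i)) (M(?b + deg i := C i (deg i) - 1, 3 + 3 * m + i := 1))"
        by (rule layout_update_D[OF layout_update_C[OF M deg_le[of i] refl] i refl])
          (auto simp: CSuc DSuc True)
      then show ?thesis
        using R bound pos True Mi Md by (simp add: I_def regs_def add.commute[of "deg i"])
    next
      case False
      \<comment> \<open>At 0 a decrement changes nothing, so skipping it agrees with the formula for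
        \<open>C (Suc i)\<close>.\<close>
      then have 0: "C i (deg i) = 0" using pos by simp
      then have "C (Suc i) = C i" by (auto simp: CSuc)
      moreover have "layout X (D (Suc i)) (C i) (M(3 + 3 * m + i := 0))"
        by (rule layout_update_D[OF M i refl]) (auto simp: DSuc False)
      ultimately show ?thesis
        using R bound 0 Mi Md by (simp add: I_def regs_def add.commute[of "deg i"])
    qed
    then show "R 9 < R 8 \<and> wp w ?body (\<lambda>t s'. t \<le> 8 \<and> I (Suc i) s') (R, M)"
      using i R by (simp add: regs_def)
  qed (auto simp: I_def regs_def)
  then show ?thesis
    by (rule triple_conseq) (auto simp: I_def layout_def C_def D_def)
qed

lemma triple_emit:
  "triple w (\<lambda>(R, M). regs R \<and> R 9 = 3 \<and> R 13 = 3 + 2 * m \<and>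
        layout (\<lambda>_. 0) (\<lambda>v. of_bool (v \<in> S)) C M)
     emit (Suc (m * 13)) (\<lambda>(R, M). \<forall>i<m. M (3 + 2 * m + i) = of_bool (edge_at es i \<inter> S \<noteq> {}))"
proof -
  define X where "X i e = (if e < i then of_bool (edge_at es e \<inter> S \<noteq> {}) else 0 :: nat)" for i e
  define I where "I i = (\<lambda>(R, M). regs R \<and> R 9 = 3 + 2 * i \<and> R 13 = 3 + 2 * m + i \<and>
    layout (X i) (\<lambda>v. of_bool (v \<in> S)) C M)" for i
  have "triple w (I 0) emit (Suc (m * Suc 12)) (I m)"
    unfolding emit_def
  proof (rule triple_While)
    fix i R M assume i: "i < m" and I: "I i (R, M)"
    obtain u v where uv: "es ! i = (u, v)" by (cases "es ! i")
    have R: "regs R" "R 9 = 3 + 2 * i" "R 13 = 3 + 2 * m + i"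
      and M: "layout (X i) (\<lambda>v. of_bool (v \<in> S)) C M" using I by (auto simp: I_def)
    have idx: "2 * i < 2 * m" "Suc (2 * i) < 2 * m" using i by auto
    then have "u \<in> set (endpoints es)" "v \<in> set (endpoints es)"
      using nth_endpoints[OF i] uv nth_mem[of _ "endpoints es"] by (metis length_endpoints fst_conv snd_conv)+
    then have lt: "u < n" "v < n" using endpoints by auto
    have read: "M (3 + 2 * i) = u" "M (3 + Suc (2 * i)) = v"
      "M (3 + 3 * m + u) = of_bool (u \<in> S)" "M (3 + 3 * m + v) = of_bool (v \<in> S)"
      using M idx nth_endpoints[OF i] uv lt unfolding layout_def by auto
    have bound: "3 + 3 * m + u < 2 ^ w" "3 + 3 * m + v < 2 ^ w" "Suc (Suc (3 + 2 * i)) < 2 ^ w"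
      "Suc (3 + 2 * m + i) < 2 ^ w" "(2::nat) < 2 ^ w"
      using i lt by (auto intro!: fits)
    have keep: "layout (X (Suc i)) (\<lambda>v. of_bool (v \<in> S)) C M" if "u \<notin> S" "v \<notin> S"
    proof -
      have "X (Suc i) e = X i e" for e using that uv by (auto simp: X_def edge_at_def less_Suc_eq)
      then show ?thesis using M by (simp add: layout_def)
    qed
    have set: "layout (X (Suc i)) (\<lambda>v. of_bool (v \<in> S)) C (M(3 + 2 * m + i := 1))"
      if "u \<in> S \<or> v \<in> S"
      by (rule layout_update_X[OF M i refl]) (use that uv in \<open>auto simp: X_def edge_at_def less_Suc_eq\<close>)
    show "R 9 < R 6 \<and> wp w (Seq (Load 10 9) (Seq (Add 10 10 7) (Seq (Load 10 10) (Seq (Add 9 9 1)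
     (Seq (Load 11 9) (Seq (Add 11 11 7) (Seq (Load 11 11) (Seq (Add 9 9 1)
     (Seq (Add 10 10 11) (Seq (IfLess 0 10 (Store 13 1) Skip) (Add 13 13 1)))))))))))
        (\<lambda>t s'. t \<le> 12 \<and> I (Suc i) s') (R, M)"
      using i R bound read keep set
      by (cases "u \<in> S"; cases "v \<in> S")
        (simp_all add: I_def regs_def add.commute[of u] add.commute[of v])
  qed (auto simp: I_def regs_def)
  then show ?thesis by (rule triple_conseq) (simp_all add: I_def layout_def X_def split: prod.splits)
qed

text \<open>The phases cost \<open>14 + 10 + 13\<close> steps per edge and \<open>7 + 9\<close> per
  vertex; halving adds \<open>3 * (k div 2) \<le> 3 * n\<close>. The additive constant is rounded
  up.\<close>

lemma triple_top_degree_edges: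
  "triple w (\<lambda>s. s = initial_config n es k) top_degree_edges (37 * m + 19 * n + 40)
     (\<lambda>(R, M). \<forall>i<m. M (3 + 2 * m + i) = of_bool (edge_at es i \<inter> {v. rank v < k div 2} \<noteq> {}))"
proof -
  let ?L = "layout (\<lambda>_. 0)" and ?S = "{v. rank v < k div 2}"
  let ?cnt = "\<lambda>d. card {v. v < n \<and> deg v = d}"
  have bound: "3 + 3 * m + n + 2 * m + 1 < 2 ^ w" "3 + 3 * m < 2 ^ w" "3 + 2 * m < 2 ^ w" "3 < (2 ^ w :: nat)"
    "3 + 3 * m + n + m < 2 ^ w" "3 + 3 * m + n + m + m < 2 ^ w"
    by (auto intro!: fits)
  have to_degrees: "triple w
      (\<lambda>(R, M). regs R \<and> R 4 = k \<and> R 12 = 0 \<and> R 13 = 0 \<and> ?L deg (\<lambda>_. 0) M) (Add 9 7 0) 1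
      (\<lambda>(R, M). regs R \<and> R 4 = k \<and> R 9 = 3 + 3 * m \<and> R 12 = 0 \<and> R 13 = 0 \<and> ?L deg (\<lambda>_. 0) M)"
    using bound by (auto simp: triple_def regs_def)
  have to_counts: "triple w
      (\<lambda>(R, M). regs R \<and> R 12 = k div 2 \<and> ?L deg ?cnt M)
      (Seq (Add 9 8 3) (Seq (Add 9 9 3) (Add 9 9 1))) 3
      (\<lambda>(R, M). regs R \<and> R 9 = 3 + 3 * m + n + (2 * m + 1) \<and> R 12 = k div 2 \<and> ?L deg ?cnt M)"
    using bound by (auto simp: triple_def regs_def)
  have to_marks: "triple w
      (\<lambda>(R, M). regs R \<and> ?L deg (\<lambda>d. k div 2 - at_least (Suc d)) M) (Add 9 7 0) 1
      (\<lambda>(R, M). regs R \<and> R 9 = 3 + 3 * m \<and> ?L deg (\<lambda>d. k div 2 - at_least (Suc d)) M)"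
    using bound by (auto simp: triple_def regs_def)
  have to_edges: "triple w
      (\<lambda>(R, M). regs R \<and> (\<exists>C. ?L (\<lambda>v. of_bool (rank v < k div 2)) C M)) (Seq (Set 9 3) (Add 13 6 0)) 2
      (\<lambda>(R, M). regs R \<and> R 9 = 3 \<and> R 13 = 3 + 2 * m \<and> (\<exists>C. ?L (\<lambda>v. of_bool (v \<in> ?S)) C M))"
    using bound by (auto simp: triple_def regs_def)
  have emit: "triple w
      (\<lambda>(R, M). regs R \<and> R 9 = 3 \<and> R 13 = 3 + 2 * m \<and> (\<exists>C. ?L (\<lambda>v. of_bool (v \<in> ?S)) C M))
      emit (Suc (m * 13)) (\<lambda>(R, M). \<forall>i<m. M (3 + 2 * m + i) = of_bool (edge_at es i \<inter> ?S \<noteq> {}))"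
    \<comment> \<open>The leftover budgets \<open>C\<close> depend on the configuration, so it is
      fixed before \<open>C\<close> is obtained.\<close>
    by (rule triple_pointwise, clarify) (rule triple_conseq[OF triple_emit], auto)
  show ?thesis
    unfolding top_degree_edges_def
    by (rule triple_conseq[OF
          triple_Seq[OF triple_load_input
          triple_Seq[OF triple_degrees
          triple_Seq[OF to_degrees
          triple_Seq[OF triple_degree_counts
          triple_Seq[OF triple_halve
          triple_Seq[OF to_counts
          triple_Seq[OF triple_budgets
          triple_Seq[OF to_marks
          triple_Seq[OF triple_mark
          triple_Seq[OF to_edges emit]]]]]]]]]]])
      (use k_le in auto)
qed

section \<open>The order by decreasing degree\<close>

lemma rank_eq:
  assumes "v < n"
  shows "rank v = card {u. u < n \<and> (deg v < deg u \<or> deg u = deg v \<and> u < v)}"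
proof -
  let ?A = "{u. u < n \<and> Suc (deg v) \<le> deg u}" and ?B = "{u. u < v \<and> deg u = deg v}"
  have "{u. u < n \<and> (deg v < deg u \<or> deg u = deg v \<and> u < v)} = ?A \<union> ?B"
    using assms by auto
  moreover have "card (?A \<union> ?B) = card ?A + card ?B" by (rule card_Un_disjoint) auto
  ultimately show ?thesis unfolding rank_def at_least_def by simp
qed

text \<open>By transitivity the predecessors of \<open>u\<close> also precede \<open>v\<close>, and
  \<open>u\<close> itself is one more.\<close>

lemma rank_less:
  assumes "u < n" "v < n" "deg v < deg u \<or> deg u = deg v \<and> u < v"
  shows "rank u < rank v"
proof -
  let ?above = "\<lambda>v. {u. u < n \<and> (deg v < deg u \<or> deg u = deg v \<and> u < v)}"
  have "?above u \<subseteq> ?above v" using assms(3) by auto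
  moreover have "u \<in> ?above v" "u \<notin> ?above u" using assms by auto
  ultimately have "?above u \<subset> ?above v" by blast
  then have "card (?above u) < card (?above v)" by (rule psubset_card_mono[rotated]) simp
  then show ?thesis unfolding rank_eq[OF assms(1)] rank_eq[OF assms(2)] .
qed

text \<open>\<open>rank\<close> is injective by \<open>rank_less\<close>, hence a permutation of
  \<open>{..<n}\<close>, and so takes each value below \<open>j\<close> exactly once.\<close>

lemma card_selected:
  assumes "j \<le> n"
  shows "card {v. v < n \<and> rank v < j} = j"
proof -
  have "rank v < n" if "v < n" for v
  proof -
    have "rank v < card {..<n}"
      unfolding rank_eq[OF that] by (rule psubset_card_mono) (use that in auto)
    then show ?thesis by simp
  qed
  then have sub: "rank ` {..<n} \<subseteq> {..<n}" by auto
  have inj: "inj_on rank {..<n}"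
  proof (rule inj_onI)
    fix u v assume "u \<in> {..<n}" "v \<in> {..<n}" "rank u = rank v"
    then show "u = v" using rank_less[of u v] rank_less[of v u] by force
  qed
  then have img: "rank ` {..<n} = {..<n}" by (simp add: sub endo_inj_surj)
  have "rank ` {v. v < n \<and> rank v < j} = {..<j}"
  proof (intro equalityI subsetI)
    fix x assume x: "x \<in> {..<j}"
    then have "x \<in> rank ` {..<n}" unfolding img using assms by simp
    then show "x \<in> rank ` {v. v < n \<and> rank v < j}" using x by auto
  qed auto
  moreover have "inj_on rank {v. v < n \<and> rank v < j}" using inj by (rule inj_on_subset) auto
  ultimately show ?thesis by (metis card_image card_lessThan)
qed

text \<open>An unselected vertex of larger degree would have smaller rank than a selected
  one.\<close>

lemma selected_highest_degree:
  assumes "j \<le> n" and "\<And>v. degree E v = deg v"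
  shows "highest_degree_vertices {..<n} E j {v. v < n \<and> rank v < j}"
  unfolding highest_degree_vertices_def
proof (intro conjI ballI)
  fix s v assume "s \<in> {v. v < n \<and> rank v < j}" "v \<in> {..<n} - {v. v < n \<and> rank v < j}"
  then have "\<not> rank v < rank s" "s < n" "v < n" by auto
  then have "\<not> deg s < deg v" using rank_less[of v s] by blast
  then show "degree E v \<le> degree E s" by (simp add: assms(2))
qed (use card_selected[OF assms(1)] in auto)

end

section \<open>From the input list to the graph\<close>

lemma count_list_endpoints:
  assumes "\<forall>e\<in>set es. fst e \<noteq> snd e"
  shows "count_list (endpoints es) v = length (filter (\<lambda>e. v \<in> {fst e, snd e}) es)"
  using assms
proof (induction es)
  case (Cons e es)
  then show ?case by (cases e) (simp add: endpoints_def)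
qed (simp add: endpoints_def)

text \<open>Two-element edges exclude loops, which would count a vertex twice, and injectivity of
  \<open>edge_at\<close> excludes repeated edges.\<close>

lemma degree_edge_list:
  assumes G: "simple_graph V E" and es: "edge_list es E"
  shows "degree E v = count_list (endpoints es) v"
proof -
  have bij: "bij_betw (edge_at es) {..<length es} E" using es by (simp add: edge_list_def)
  have "fst e \<noteq> snd e" if e: "e \<in> set es" for e
  proof -
    obtain i where i: "i < length es" "es ! i = e" using e unfolding in_set_conv_nth by blast
    then have "edge_at es i \<in> E" using bij by (auto simp: bij_betw_def)
    then have "card {fst e, snd e} = 2" using G i by (auto simp: simple_graph_def edge_at_def)
    then show ?thesis by auto
  qed
  then have "count_list (endpoints es) v = length (filter (\<lambda>e. v \<in> {fst e, snd e}) es)"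
    by (intro count_list_endpoints ballI)
  also have "\<dots> = card {i. i < length es \<and> v \<in> edge_at es i}"
    by (simp add: length_filter_conv_card edge_at_def)
  also have "\<dots> = card (edge_at es ` {i. i < length es \<and> v \<in> edge_at es i})"
    by (rule card_image[symmetric], rule inj_on_subset[OF bij_betw_imp_inj_on[OF bij]]) auto
  also have "edge_at es ` {i. i < length es \<and> v \<in> edge_at es i} = {e \<in> E. v \<in> e}"
    using bij by (auto simp: bij_betw_def)
  finally show ?thesis by (simp add: degree_def)
qed

lemma computes_top_degree_edges:
  "computes_in_time top_degree_edges (\<lambda>m. 100 * m + 100)
     (\<lambda>V E k. even k \<and> k \<le> card V)
     (\<lambda>V E k C. \<exists>S. highest_degree_vertices V E (k div 2) S \<and> C = incident_edges E S)"
  unfolding computes_in_time_def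
proof (rule exI[of _ 10], intro allI impI)
  fix n E es k w
  assume "connected_graph {..<n} E \<and> edge_list es E \<and> (even k \<and> k \<le> card {..<n}) \<and>
    10 * (n + length es + 1) \<le> 2 ^ w"
  then have G: "connected_graph {..<n} E" and es: "edge_list es E"
    and k: "even k" "k \<le> card {..<n}" and w: "10 * (n + length es + 1) \<le> 2 ^ w" by simp_all
  have simple: "simple_graph {..<n} E" using G by (simp add: connected_graph_def)
  have bij: "bij_betw (edge_at es) {..<length es} E" using es by (simp add: edge_list_def)
  then have edges: "edge_at es i \<in> E" if "i < length es" for i using that by (auto simp: bij_betw_def)
  then have sub: "edge_at es i \<subseteq> {..<n}" if "i < length es" for i
    using that simple unfolding simple_graph_def by blast
  have m: "card E = length es" using bij_betw_same_card[OF bij] by simp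
  interpret instance_on_word_RAM n k w es
    by unfold_locales (use w k sub in \<open>auto simp: set_endpoints\<close>)
  let ?S = "{v. v < n \<and> rank v < k div 2}"
  obtain t R M where t: "exec w top_degree_edges (initial_config n es k) t (R, M)"
      "t \<le> 37 * length es + 19 * n + 40"
    and M: "\<And>i. i < length es \<Longrightarrow>
      M (3 + 2 * length es + i) = of_bool (edge_at es i \<inter> {v. rank v < k div 2} \<noteq> {})"
    using triple_top_degree_edges unfolding triple_def wp_def by auto
  \<comment> \<open>This reduces the bound to \<open>56 * m + 59\<close> with
    \<open>m = card E\<close>.\<close>
  have "n \<le> Suc (length es)" using connected_card_vertices_le[OF G] m by simp
  then have time: "t \<le> 100 * card E + 100" using t(2) m by simp
  have top: "highest_degree_vertices {..<n} E (k div 2) ?S"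
    by (rule selected_highest_degree) (use k degree_edge_list[OF simple es] in auto)
  have out: "outputs es (R, M) (incident_edges E ?S)"
    unfolding outputs_def
  proof (intro allI impI)
    fix i assume i: "i < length es"
    \<comment> \<open>\<open>rank\<close> is defined on all naturals, but the ends of edges are
      below \<open>n\<close>.\<close>
    have "edge_at es i \<inter> {v. rank v < k div 2} = edge_at es i \<inter> ?S" using sub[OF i] by auto
    then show "snd (R, M) (3 + 2 * length es + i) = (if edge_at es i \<in> incident_edges E ?S then 1 else 0)"
      using M[OF i] edges[OF i] by (simp add: incident_edges_def)
  qed
  show "\<exists>t s C. exec w top_degree_edges (initial_config n es k) t s \<and> t \<le> 100 * card E + 100 \<and>
      (\<exists>S. highest_degree_vertices {..<n} E (k div 2) S \<and> C = incident_edges E S) \<and> outputs es s C"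
    by (rule exI[of _ t], rule exI[of _ "(R, M)"], rule exI[of _ "incident_edges E ?S"])
      (intro conjI t(1) time out exI[of _ ?S] top refl)
qed

theorem theorem30:
  "(\<forall>(V :: 'a set) E k S.
      connected_graph V E \<and> even k \<and> k \<le> card V \<and> highest_degree_vertices V E (k div 2) S \<longrightarrow>
        contraction V E k (incident_edges E S) \<and>
        \<Phi> V E (incident_edges E S) \<ge> real k * real (card E) / (2 * real (card V))) \<and>
   (\<exists>P T. (\<lambda>m. real (T m)) \<in> O(\<lambda>m. real m) \<and>
      computes_in_time P T
        (\<lambda>V E k. even k \<and> k \<le> card V)
        (\<lambda>V E k C. \<exists>S. highest_degree_vertices V E (k div 2) S \<and> C = incident_edges E S))"
proof (rule conjI, intro allI impI)
  fix V :: "'a set" and E k S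
  assume "connected_graph V E \<and> even k \<and> k \<le> card V \<and> highest_degree_vertices V E (k div 2) S"
  then have G: "connected_graph V E" and k: "even k" "k \<le> card V"
    and S: "highest_degree_vertices V E (k div 2) S" by simp_all
  have "contraction V E k (incident_edges E S)"
    by (rule incident_edges_contraction[OF G]) (use S k in \<open>auto simp: highest_degree_vertices_def\<close>)
  moreover obtain j where "k = 2 * j" using k(1) by (rule evenE)
  then have "\<Phi> V E (incident_edges E S) \<ge> real k * real (card E) / (2 * real (card V))"
    using \<Phi>_incident_edges_ge[OF G S] by simp
  ultimately show "contraction V E k (incident_edges E S) \<and>
      \<Phi> V E (incident_edges E S) \<ge> real k * real (card E) / (2 * real (card V))" ..
next
  have "(\<lambda>m. real (100 * m + 100)) \<in> O(\<lambda>m. real m)"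
  proof (rule bigoI)
    \<comment> \<open>For \<open>m \<ge> 1\<close> the additive constant is absorbed by doubling the
      factor.\<close>
    have "norm (real (100 * m + 100)) \<le> 200 * norm (real m)" if "1 \<le> m" for m
      using that by simp
    then show "\<forall>\<^sub>F m in sequentially. norm (real (100 * m + 100)) \<le> 200 * norm (real m)"
      by (rule eventually_sequentiallyI)
  qed
  then show "\<exists>P T. (\<lambda>m. real (T m)) \<in> O(\<lambda>m. real m) \<and>
      computes_in_time P T
        (\<lambda>V E k. even k \<and> k \<le> card V)
        (\<lambda>V E k C. \<exists>S. highest_degree_vertices V E (k div 2) S \<and> C = incident_edges E S)"
    using computes_top_degree_edges by (intro exI[of _ top_degree_edges] exI[of _ "\<lambda>m. 100 * m + 100"]) simp
qed

end
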